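(* Let $p$ be an odd prime, $\Pi$ a $p$-finite profinite group, $A$ a local noetherian pro-$p$ domain with field of fractions $K$, and $(t,d):\Pi\to A$ a continuous pseudorepresentation with adjoint trace ring $A_0$. Suppose $(t,d)$ is $B$-full for some subring $B$ of $K$. Then $B\cap A_0$ is a fullness peer of $B$ contained in $A_0$.
   Context: A local pro-$p$ ring is a commutative local topological ring that is an inverse limit of finite rings of $p$-power order, with finite residue field. A profinite group $\Pi$ is $p$-finite if for every open subgroup $\Pi_0\subseteq\Pi$ the set of continuous homomorphisms $\Pi_0\to\mathbb F_p$ is finite. A (2-dimensional) pseudorepresentation of a group $G$ over a commutative ring $B$ is a pair of functions $t:G\to B$, $d:G\to B^\times$ with $t(1)=2$, $d(gh)=d(g)d(h)$, $t(gh)=t(hg)$ and $t(gh)+d(h)t(gh^{-1})=t(g)t(h)$ for all $g,h\in G$; it is continuous if $t,d$ are. The adjoint trace ring $A_0$ of $(t,d)$ is the closed subring of $A$ topologically generated by $t(g)^2/d(g)$, $g\in\Pi$. Generalized matrix algebras: a GMA over $A$ is given by $A$-modules $M,N$ and an $A$-linear $m:M\otimes_AN\to A$ with $m(b\otimes c)b'=m(b'\otimes c)b$ and $m(b\otimes c')c=m(b\otimes c)c'$; the associated $A$-algebra is $R=\begin{pmatrix}A&M\\N&A\end{pmatrix}$ with matrix multiplication using $m$ for products of off-diagonal entries, and trace and determinant $\operatorname{tr}\begin{pmatrix}a&b\\c&e\end{pmatrix}=a+e$, $\det\begin{pmatrix}a&b\\c&e\end{pmatrix}=ae-m(b\otimes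 c)$. $R$ is faithful if $m$ is nondegenerate. A $(t,d)$-representation is a group homomorphism $\rho:\Pi\to R^\times$, $R$ a faithful GMA over $A$, with $\operatorname{tr}\rho=t$, $\det\rho=d$ and $A\rho(\Pi)=R$. As $A$ is a domain, $M,N$ embed $A$-linearly in $K$ so that $m$ becomes multiplication in $K$, giving an embedding $\iota:R\hookrightarrow M_2(K)$. Fullness: for a ring $B$ and nonzero ideal $\mathfrak b$, $\Gamma_B(\mathfrak b)=\ker(\mathrm{SL}_2(B)\to\mathrm{SL}_2(B/\mathfrak b))$. For a subring $B$ of $K$, $(t,d)$ is $B$-full if there are a $(t,d)$-representation $\rho:\Pi\to R^\times$, an embedding $\iota:R\hookrightarrow M_2(K)$, a nonzero ideal $\mathfrak b$ of $B$ and $x\in\mathrm{GL}_2(K)$ with $x^{-1}\iota(\rho(\Pi))x\supseteq\Gamma_B(\mathfrak b)$. Two subrings $B_1,B_2$ of $K$ are fullness peers if every nonzero ideal of $B_1$ contains a nonzero ideal of $B_2$ and vice versa. *)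

theory Defs
  imports
    "HOL-Analysis.Analysis"
    "HOL-Computational_Algebra.Polynomial_Factorial"
    "HOL-Algebra.Algebra"
    "HOL-Algebra.Algebraic_Closure_Type"
begin

text \<open>
  The ring \<open>A\<close> is a type \<open>'a\<close>, its field of fractions \<open>K\<close> is the type \<open>'a fract\<close> with
  \<^const>\<open>to_fract\<close> as the inclusion of \<open>A\<close>.  For ideals, subrings and units both are read as
  rings in the sense of \<open>HOL-Algebra\<close> through \<^const>\<open>ring_of_type_algebra\<close>.  The group
  \<open>\<Pi>\<close> is a group \<open>G\<close> of \<open>HOL-Algebra\<close> together with a topology on its carrier.
\<close>

subsection \<open>Profinite groups\<close>

definition topological_group :: "('g, 'x) monoid_scheme \<Rightarrow> 'g topology \<Rightarrow> bool" where
  "topological_group G T \<longleftrightarrow>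
     group G \<and> topspace T = carrier G \<and>
     continuous_map (prod_topology T T) T (\<lambda>(g, h). g \<otimes>\<^bsub>G\<^esub> h) \<and>
     continuous_map T T (\<lambda>g. inv\<^bsub>G\<^esub> g)"

definition profinite_group :: "('g, 'x) monoid_scheme \<Rightarrow> 'g topology \<Rightarrow> bool" where
  "profinite_group G T \<longleftrightarrow>
     topological_group G T \<and> compact_space T \<and> Hausdorff_space T \<and>
     (\<forall>S. connectedin T S \<longrightarrow> (\<exists>a. S \<subseteq> {a}))"

text \<open>
  Homomorphisms are taken extensional on \<open>H\<close>, so that each one is counted once.
\<close>

definition p_finite :: "nat \<Rightarrow> ('g, 'x) monoid_scheme \<Rightarrow> 'g topology \<Rightarrow> bool" where
  "p_finite p G T \<longleftrightarrow>
     (\<forall>H. subgroup H G \<and> openin T H \<longrightarrow>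
        finite {f \<in> hom (G\<lparr>carrier := H\<rparr>) (integer_mod_group p).
                  f \<in> extensional H \<and>
                  continuous_map (subtopology T H)
                    (discrete_topology (carrier (integer_mod_group p))) f})"

subsection \<open>Local pro-\<open>p\<close> rings\<close>

text \<open>
  An inverse system of rings \<open>R i\<close> over a directed preorder \<open>lq\<close> on \<open>I\<close>, with transition maps
  \<open>f i j : R j \<rightarrow> R i\<close> for \<open>lq i j\<close>.
\<close>

definition inverse_system ::
  "'i set \<Rightarrow> ('i \<Rightarrow> 'i \<Rightarrow> bool) \<Rightarrow> ('i \<Rightarrow> 'r ring) \<Rightarrow> ('i \<Rightarrow> 'i \<Rightarrow> 'r \<Rightarrow> 'r) \<Rightarrow> bool" where
  "inverse_system I lq R f \<longleftrightarrow>
     I \<noteq> {} \<and>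
     (\<forall>i\<in>I. lq i i) \<and>
     (\<forall>i\<in>I. \<forall>j\<in>I. \<forall>k\<in>I. lq i j \<and> lq j k \<longrightarrow> lq i k) \<and>
     (\<forall>i\<in>I. \<forall>j\<in>I. \<exists>k\<in>I. lq i k \<and> lq j k) \<and>
     (\<forall>i\<in>I. ring (R i)) \<and>
     (\<forall>i\<in>I. \<forall>j\<in>I. lq i j \<longrightarrow> f i j \<in> ring_hom (R j) (R i)) \<and>
     (\<forall>i\<in>I. \<forall>x\<in>carrier (R i). f i i x = x) \<and>
     (\<forall>i\<in>I. \<forall>j\<in>I. \<forall>k\<in>I. lq i j \<and> lq j k \<longrightarrow>
        (\<forall>x\<in>carrier (R k). f i j (f j k x) = f i k x))"

definition inverse_limit ::
  "'i set \<Rightarrow> ('i \<Rightarrow> 'i \<Rightarrow> bool) \<Rightarrow> ('i \<Rightarrow> 'r ring) \<Rightarrow> ('i \<Rightarrow> 'i \<Rightarrow> 'r \<Rightarrow> 'r) \<Rightarrow> ('i \<Rightarrow> 'r) ring" where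
  "inverse_limit I lq R f =
     \<lparr>carrier = {x \<in> \<Pi>\<^sub>E i\<in>I. carrier (R i). \<forall>i\<in>I. \<forall>j\<in>I. lq i j \<longrightarrow> f i j (x j) = x i},
      monoid.mult = (\<lambda>x y. \<lambda>i\<in>I. x i \<otimes>\<^bsub>R i\<^esub> y i),
      one = (\<lambda>i\<in>I. \<one>\<^bsub>R i\<^esub>),
      ring.zero = (\<lambda>i\<in>I. \<zero>\<^bsub>R i\<^esub>),
      add = (\<lambda>x y. \<lambda>i\<in>I. x i \<oplus>\<^bsub>R i\<^esub> y i)\<rparr>"

definition inverse_limit_topology ::
  "'i set \<Rightarrow> ('i \<Rightarrow> 'i \<Rightarrow> bool) \<Rightarrow> ('i \<Rightarrow> 'r ring) \<Rightarrow> ('i \<Rightarrow> 'i \<Rightarrow> 'r \<Rightarrow> 'r) \<Rightarrow> ('i \<Rightarrow> 'r) topology" where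
  "inverse_limit_topology I lq R f =
     subtopology (product_topology (\<lambda>i. discrete_topology (carrier (R i))) I)
       (carrier (inverse_limit I lq R f))"

text \<open>
  The type argument \<open>'i\<close> is the type from which the index set of the inverse system is taken; a
  statement that is polymorphic in \<open>'i\<close> speaks about all index sets.  Finite rings may be taken
  with carrier in \<^typ>\<open>nat\<close>.  That \<open>'a\<close> is a topological ring is expressed by its sort.
\<close>

definition local_pro_p_ring ::
  "'i itself \<Rightarrow> nat \<Rightarrow>
   'a::{comm_ring_1, topological_ab_group_add, topological_semigroup_mult} itself \<Rightarrow> bool" where
  "local_pro_p_ring _ p _ \<longleftrightarrow>
     (\<exists>!\<mm>. maximalideal \<mm> (ring_of_type_algebra :: 'a ring)) \<and>
     (\<forall>\<mm>. maximalideal \<mm> (ring_of_type_algebra :: 'a ring) \<longrightarrow>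
        finite (carrier ((ring_of_type_algebra :: 'a ring) Quot \<mm>))) \<and>
     (\<exists>(I :: 'i set) lq (R :: 'i \<Rightarrow> nat ring) f.
        inverse_system I lq R f \<and>
        (\<forall>i\<in>I. finite (carrier (R i)) \<and> (\<exists>k. card (carrier (R i)) = p ^ k)) \<and>
        (\<exists>\<phi> \<in> ring_iso (ring_of_type_algebra :: 'a ring) (inverse_limit I lq R f).
           homeomorphic_map euclidean (inverse_limit_topology I lq R f) \<phi>))"

subsection \<open>Pseudorepresentations\<close>

definition pseudorepresentation ::
  "('g, 'x) monoid_scheme \<Rightarrow> ('g \<Rightarrow> 'b::comm_ring_1) \<Rightarrow> ('g \<Rightarrow> 'b) \<Rightarrow> bool" where
  "pseudorepresentation G t d \<longleftrightarrow>
     (\<forall>g\<in>carrier G. d g \<in> Units (ring_of_type_algebra :: 'b ring)) \<and>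
     t \<one>\<^bsub>G\<^esub> = 2 \<and>
     (\<forall>g\<in>carrier G. \<forall>h\<in>carrier G.
        d (g \<otimes>\<^bsub>G\<^esub> h) = d g * d h \<and>
        t (g \<otimes>\<^bsub>G\<^esub> h) = t (h \<otimes>\<^bsub>G\<^esub> g) \<and>
        t (g \<otimes>\<^bsub>G\<^esub> h) + d h * t (g \<otimes>\<^bsub>G\<^esub> inv\<^bsub>G\<^esub> h) = t g * t h)"

text \<open>
  Since \<open>d\<close> is multiplicative, continuity of \<open>d\<close> as a map into the ring is the same as continuity
  into its group of units when \<open>G\<close> is a topological group.
\<close>

definition continuous_pseudorepresentation ::
  "('g, 'x) monoid_scheme \<Rightarrow> 'g topology \<Rightarrow>
   ('g \<Rightarrow> 'b::{comm_ring_1, topological_space}) \<Rightarrow> ('g \<Rightarrow> 'b) \<Rightarrow> bool" where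
  "continuous_pseudorepresentation G T t d \<longleftrightarrow>
     pseudorepresentation G t d \<and>
     continuous_map T euclidean t \<and> continuous_map T euclidean d"

definition adjoint_trace_ring ::
  "('g, 'x) monoid_scheme \<Rightarrow> ('g \<Rightarrow> 'a::{comm_ring_1, topological_space}) \<Rightarrow> ('g \<Rightarrow> 'a) \<Rightarrow> 'a set" where
  "adjoint_trace_ring G t d =
     \<Inter>{S. subring S (ring_of_type_algebra :: 'a ring) \<and> closed S \<and>
         (\<lambda>g. (t g)\<^sup>2 * inv\<^bsub>(ring_of_type_algebra :: 'a ring)\<^esub> d g) ` carrier G \<subseteq> S}"

subsection \<open>Generalized matrix algebras\<close>

text \<open>
  The \<open>A\<close>-modules \<open>M\<close> and \<open>N\<close> are given by scalar multiplications \<open>sM\<close> and \<open>sN\<close> on types \<open>'m\<close>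
  and \<open>'n\<close>; an \<open>A\<close>-linear map \<open>M \<otimes> N \<rightarrow> A\<close> is given as a bilinear map \<open>m\<close>.
  A tuple \<open>(a, b, c, e)\<close> stands for the matrix with rows \<open>a b\<close> and \<open>c e\<close>.
\<close>

definition gma ::
  "('a::comm_ring_1 \<Rightarrow> 'm::ab_group_add \<Rightarrow> 'm) \<Rightarrow> ('a \<Rightarrow> 'n::ab_group_add \<Rightarrow> 'n) \<Rightarrow>
   ('m \<Rightarrow> 'n \<Rightarrow> 'a) \<Rightarrow> bool" where
  "gma sM sN m \<longleftrightarrow>
     Modules.module sM \<and> Modules.module sN \<and>
     (\<forall>c. module_hom sM (*) (\<lambda>b. m b c)) \<and>
     (\<forall>b. module_hom sN (*) (\<lambda>c. m b c)) \<and>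
     (\<forall>b b' c. sM (m b c) b' = sM (m b' c) b) \<and>
     (\<forall>b c c'. sN (m b c') c = sN (m b c) c')"

definition gma_faithful :: "('m::zero \<Rightarrow> 'n::zero \<Rightarrow> 'a::zero) \<Rightarrow> bool" where
  "gma_faithful m \<longleftrightarrow>
     (\<forall>b. (\<forall>c. m b c = 0) \<longrightarrow> b = 0) \<and> (\<forall>c. (\<forall>b. m b c = 0) \<longrightarrow> c = 0)"

definition gma_ring ::
  "('a::comm_ring_1 \<Rightarrow> 'm::ab_group_add \<Rightarrow> 'm) \<Rightarrow> ('a \<Rightarrow> 'n::ab_group_add \<Rightarrow> 'n) \<Rightarrow>
   ('m \<Rightarrow> 'n \<Rightarrow> 'a) \<Rightarrow> ('a \<times> 'm \<times> 'n \<times> 'a) ring" where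
  "gma_ring sM sN m =
     \<lparr>carrier = UNIV,
      monoid.mult = (\<lambda>(a, b, c, e) (a', b', c', e').
        (a * a' + m b c', sM a b' + sM e' b, sN a' c + sN e c', m b' c + e * e')),
      one = (1, 0, 0, 1),
      ring.zero = 0,
      add = (+)\<rparr>"

definition gma_scale ::
  "('a::comm_ring_1 \<Rightarrow> 'm \<Rightarrow> 'm) \<Rightarrow> ('a \<Rightarrow> 'n \<Rightarrow> 'n) \<Rightarrow> 'a \<Rightarrow> 'a \<times> 'm \<times> 'n \<times> 'a \<Rightarrow> 'a \<times> 'm \<times> 'n \<times> 'a" where
  "gma_scale sM sN r = (\<lambda>(a, b, c, e). (r * a, sM r b, sN r c, r * e))"

definition gma_trace :: "'a::comm_ring_1 \<times> 'm \<times> 'n \<times> 'a \<Rightarrow> 'a" where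
  "gma_trace = (\<lambda>(a, b, c, e). a + e)"

definition gma_det :: "('m \<Rightarrow> 'n \<Rightarrow> 'a::comm_ring_1) \<Rightarrow> 'a \<times> 'm \<times> 'n \<times> 'a \<Rightarrow> 'a" where
  "gma_det m = (\<lambda>(a, b, c, e). a * e - m b c)"

definition td_representation ::
  "('g, 'x) monoid_scheme \<Rightarrow> ('g \<Rightarrow> 'a::comm_ring_1) \<Rightarrow> ('g \<Rightarrow> 'a) \<Rightarrow>
   ('a \<Rightarrow> 'm::ab_group_add \<Rightarrow> 'm) \<Rightarrow> ('a \<Rightarrow> 'n::ab_group_add \<Rightarrow> 'n) \<Rightarrow> ('m \<Rightarrow> 'n \<Rightarrow> 'a) \<Rightarrow>
   ('g \<Rightarrow> 'a \<times> 'm \<times> 'n \<times> 'a) \<Rightarrow> bool" where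
  "td_representation G t d sM sN m \<rho> \<longleftrightarrow>
     gma sM sN m \<and> gma_faithful m \<and>
     \<rho> \<in> hom G (units_of (gma_ring sM sN m)) \<and>
     (\<forall>g\<in>carrier G. gma_trace (\<rho> g) = t g) \<and>
     (\<forall>g\<in>carrier G. gma_det m (\<rho> g) = d g) \<and>
     Modules.module.span (gma_scale sM sN) (\<rho> ` carrier G) = UNIV"

text \<open>
  The embeddings into \<open>M\<^sub>2(K)\<close> are those induced by \<open>A\<close>-linear embeddings \<open>u\<close> of \<open>M\<close> and \<open>v\<close>
  of \<open>N\<close> into \<open>K\<close> under which \<open>m\<close> becomes the multiplication of \<open>K\<close>.
\<close>

definition gma_embedding ::
  "('a::idom \<Rightarrow> 'm::ab_group_add \<Rightarrow> 'm) \<Rightarrow> ('a \<Rightarrow> 'n::ab_group_add \<Rightarrow> 'n) \<Rightarrow> ('m \<Rightarrow> 'n \<Rightarrow> 'a) \<Rightarrow>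
   ('a \<times> 'm \<times> 'n \<times> 'a \<Rightarrow> 'a fract ^ 2 ^ 2) \<Rightarrow> bool" where
  "gma_embedding sM sN m \<iota> \<longleftrightarrow>
     (\<exists>u v. module_hom sM (\<lambda>a z. to_fract a * z) u \<and> inj u \<and>
            module_hom sN (\<lambda>a z. to_fract a * z) v \<and> inj v \<and>
            (\<forall>b c. u b * v c = to_fract (m b c)) \<and>
            \<iota> = (\<lambda>(a, b, c, e). vector [vector [to_fract a, u b], vector [v c, to_fract e]]))"

subsection \<open>Fullness\<close>

text \<open>The subset \<open>B\<close> of the field \<open>K\<close>, regarded as a ring.\<close>

abbreviation subring_of :: "'k::field set \<Rightarrow> 'k ring" where
  "subring_of B \<equiv> ring_of_type_algebra\<lparr>carrier := B\<rparr>"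

text \<open>
  The matrices in \<open>SL\<^sub>2(B)\<close> whose entries have the same classes in \<open>B/\<bb>\<close> as those of the identity.
\<close>

definition congruence_subgroup :: "'k::field set \<Rightarrow> 'k set \<Rightarrow> ('k ^ 2 ^ 2) set" where
  "congruence_subgroup B \<bb> =
     {Y. (\<forall>i j. Y $ i $ j \<in> B) \<and> det Y = 1 \<and>
         (\<forall>i j. \<bb> +>\<^bsub>subring_of B\<^esub> (Y $ i $ j) = \<bb> +>\<^bsub>subring_of B\<^esub> ((mat 1 :: 'k ^ 2 ^ 2) $ i $ j))}"

text \<open>
  The type arguments are the types of the modules \<open>M\<close> and \<open>N\<close> of the generalized matrix algebra; a
  statement with a fullness hypothesis that is polymorphic in them speaks about all modules.
\<close>

definition full ::
  "'m::ab_group_add itself \<Rightarrow> 'n::ab_group_add itself \<Rightarrow> ('g, 'x) monoid_scheme \<Rightarrow>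
   ('g \<Rightarrow> 'a::idom) \<Rightarrow> ('g \<Rightarrow> 'a) \<Rightarrow> 'a fract set \<Rightarrow> bool" where
  "full _ _ G t d B \<longleftrightarrow>
     (\<exists>(sM :: 'a \<Rightarrow> 'm \<Rightarrow> 'm) (sN :: 'a \<Rightarrow> 'n \<Rightarrow> 'n) m \<rho> \<iota> \<bb> x.
        td_representation G t d sM sN m \<rho> \<and>
        gma_embedding sM sN m \<iota> \<and>
        ideal \<bb> (subring_of B) \<and> \<bb> \<noteq> {0} \<and>
        invertible x \<and>
        congruence_subgroup B \<bb> \<subseteq> (\<lambda>g. matrix_inv x ** \<iota> (\<rho> g) ** x) ` carrier G)"

definition fullness_peers :: "'k::field set \<Rightarrow> 'k set \<Rightarrow> bool" where
  "fullness_peers B1 B2 \<longleftrightarrow>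
     subring B1 ring_of_type_algebra \<and> subring B2 ring_of_type_algebra \<and>
     (\<forall>I. ideal I (subring_of B1) \<and> I \<noteq> {0} \<longrightarrow>
        (\<exists>J. ideal J (subring_of B2) \<and> J \<noteq> {0} \<and> J \<subseteq> I)) \<and>
     (\<forall>I. ideal I (subring_of B2) \<and> I \<noteq> {0} \<longrightarrow>
        (\<exists>J. ideal J (subring_of B1) \<and> J \<noteq> {0} \<and> J \<subseteq> I))"

end

theory Submission
  imports Defs
begin

text \<open>
  Conjugation and the embedding into \<open>M\<^sub>2(K)\<close> preserve trace and determinant.  A matrix \<open>Y\<close> of
  determinant \<open>1\<close> in the conjugated image of \<open>\<rho>\<close> therefore comes from some \<open>g\<close> with \<open>d g = 1\<close> and
  \<open>t g = trace Y\<close>, so that \<open>(trace Y)\<^sup>2\<close> lies in the adjoint trace ring \<open>A\<^sub>0\<close>.  Fullness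
  applies this to all of \<open>\<Gamma>\<^sub>B(\<bb>)\<close>.

  Let \<open>s\<close> be a nonzero element of \<open>\<bb>\<close>.  For \<open>r \<in> B\<close> the product of an upper and a lower
  unipotent matrix with entries \<open>s * r\<close> and \<open>s\<close> lies in \<open>\<Gamma>\<^sub>B(\<bb>)\<close> and has trace \<open>2 + z\<close>, where
  \<open>z = s\<^sup>2 * r\<close>.  Hence \<open>4 * z + z\<^sup>2 \<in> A\<^sub>0\<close> for every \<open>z\<close> in the ideal \<open>s\<^sup>2 B\<close>.  The polarization
  of this quadratic map is \<open>(z, w) \<mapsto> 2 * z * w\<close>, so \<open>A\<^sub>0\<close> contains the ideal \<open>2 * s\<^sup>4 * B\<close>
  of \<open>B\<close> (lemma \<open>full_imp_multiple_subset_adjoint_trace_ring\<close>).  This ideal is nonzero, because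
  an inverse limit of rings of odd order that is a domain cannot have characteristic two (lemma
  \<open>two_neq_zero_of_local_pro_p\<close>).

  Finally, two rings \<open>C \<subseteq> B\<close> such that \<open>C\<close> contains a nonzero ideal of \<open>B\<close> are fullness peers
  (lemma \<open>fullness_peers_of_conductor\<close>); this is used for \<open>C = B \<inter> A\<^sub>0\<close>.
\<close>

section \<open>Subrings and ideals of types\<close>

lemma ring_of_type_algebra_sel [simp]:
  "carrier (ring_of_type_algebra :: 'b::comm_ring_1 ring) = UNIV"
  "x \<otimes>\<^bsub>(ring_of_type_algebra :: 'b ring)\<^esub> y = x * y"
  "x \<oplus>\<^bsub>(ring_of_type_algebra :: 'b ring)\<^esub> y = x + y"
  "\<one>\<^bsub>(ring_of_type_algebra :: 'b ring)\<^esub> = 1"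
  "\<zero>\<^bsub>(ring_of_type_algebra :: 'b ring)\<^esub> = 0"
  by (simp_all add: ring_of_type_algebra_def)

lemma a_inv_ring_of_type_algebra [simp]:
  "\<ominus>\<^bsub>(ring_of_type_algebra :: 'b::comm_ring_1 ring)\<^esub> x = - x"
  using abelian_group.minus_equality[OF ring.is_abelian_group[OF ring_from_type_algebra], of "- x" x]
  by simp

lemma subring_type_iff:
  fixes B :: "'b::comm_ring_1 set"
  shows "subring B ring_of_type_algebra \<longleftrightarrow>
    1 \<in> B \<and> (\<forall>x\<in>B. - x \<in> B) \<and> (\<forall>x\<in>B. \<forall>y\<in>B. x * y \<in> B) \<and> (\<forall>x\<in>B. \<forall>y\<in>B. x + y \<in> B)"
proof
  assume "subring B (ring_of_type_algebra :: 'b ring)"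
  from subringE(3,5-7)[OF this] show "1 \<in> B \<and> (\<forall>x\<in>B. - x \<in> B) \<and>
      (\<forall>x\<in>B. \<forall>y\<in>B. x * y \<in> B) \<and> (\<forall>x\<in>B. \<forall>y\<in>B. x + y \<in> B)"
    by simp
next
  assume "1 \<in> B \<and> (\<forall>x\<in>B. - x \<in> B) \<and>
      (\<forall>x\<in>B. \<forall>y\<in>B. x * y \<in> B) \<and> (\<forall>x\<in>B. \<forall>y\<in>B. x + y \<in> B)"
  then show "subring B (ring_of_type_algebra :: 'b ring)"
    by (intro ring.subringI[OF ring_from_type_algebra]) simp_all
qed

lemma subring_zero:
  fixes B :: "'b::comm_ring_1 set"
  assumes "subring B ring_of_type_algebra"
  shows "0 \<in> B"
  using subringE(2)[OF assms] by simp

lemma ring_subring_of: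
  assumes "subring B (ring_of_type_algebra :: 'k::field ring)"
  shows "ring (subring_of B)"
  by (rule ring.subring_is_ring[OF ring_from_type_algebra assms])

lemma ideal_subring_of_iff:
  fixes B :: "'k::field set"
  assumes B: "subring B ring_of_type_algebra"
  shows "ideal I (subring_of B) \<longleftrightarrow>
    I \<subseteq> B \<and> 0 \<in> I \<and> (\<forall>x\<in>I. \<forall>y\<in>I. x + y \<in> I) \<and> (\<forall>r\<in>B. \<forall>x\<in>I. r * x \<in> I)"
proof
  assume "ideal I (subring_of B)"
  then interpret ideal I "subring_of B" .
  show "I \<subseteq> B \<and> 0 \<in> I \<and> (\<forall>x\<in>I. \<forall>y\<in>I. x + y \<in> I) \<and> (\<forall>r\<in>B. \<forall>x\<in>I. r * x \<in> I)"
    using a_subset additive_subgroup.zero_closed[OF additive_subgroup_axioms]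
      additive_subgroup.a_closed[OF additive_subgroup_axioms] I_l_closed
    by simp
next
  assume I: "I \<subseteq> B \<and> 0 \<in> I \<and> (\<forall>x\<in>I. \<forall>y\<in>I. x + y \<in> I) \<and> (\<forall>r\<in>B. \<forall>x\<in>I. r * x \<in> I)"
  interpret R: ring "subring_of B" by (rule ring_subring_of[OF B])
  have m1: "- 1 \<in> B" using B by (simp add: subring_type_iff)
  have neg: "\<ominus>\<^bsub>subring_of B\<^esub> x = - x" if "x \<in> B" for x
    using R.minus_equality[of "- x" x] that B by (simp add: subring_type_iff)
  have "- x \<in> I" if "x \<in> I" for x
    using I m1 that by (metis mult_minus1)
  then have "subgroup I (add_monoid (subring_of B))"
    using I neg by (intro R.add.subgroupI) (auto simp flip: a_inv_def)
  then show "ideal I (subring_of B)"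
    using I by (intro idealI[OF R.ring_axioms]) (simp_all, metis mult.commute)
qed

lemma subring_to_fract_image:
  fixes S :: "'a::idom set"
  assumes "subring S ring_of_type_algebra"
  shows "subring (to_fract ` S) ring_of_type_algebra"
proof -
  have "to_fract 1 \<in> to_fract ` S"
    using assms unfolding subring_type_iff by blast
  moreover have "- to_fract x \<in> to_fract ` S" if "x \<in> S" for x
    using assms that unfolding subring_type_iff to_fract_uminus[symmetric] by blast
  moreover have "to_fract x * to_fract y \<in> to_fract ` S" if "x \<in> S" "y \<in> S" for x y
    using assms that unfolding subring_type_iff to_fract_mult[symmetric] by blast
  moreover have "to_fract x + to_fract y \<in> to_fract ` S" if "x \<in> S" "y \<in> S" for x y
    using assms that unfolding subring_type_iff to_fract_add[symmetric] by blast
  ultimately show ?thesis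
    unfolding subring_type_iff by simp
qed

lemma subring_adjoint_trace_ring:
  "subring (adjoint_trace_ring G t d) (ring_of_type_algebra :: 'a::{comm_ring_1, topological_space} ring)"
  unfolding adjoint_trace_ring_def
  using ring.carrier_is_subring[OF ring_from_type_algebra[where 'a='a]]
  by (intro ring.subring_Inter[OF ring_from_type_algebra]) auto

lemma trace_square_in_adjoint_trace_ring:
  fixes t d :: "'g \<Rightarrow> 'a::{comm_ring_1, topological_space}"
  assumes "g \<in> carrier G" and "d g = 1"
  shows "(t g)\<^sup>2 \<in> adjoint_trace_ring G t d"
proof -
  have "inv\<^bsub>(ring_of_type_algebra :: 'a ring)\<^esub> 1 = 1"
    using monoid.inv_one[OF ring.is_monoid[OF ring_from_type_algebra[where 'a='a]]] by simp
  then show ?thesis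
    using assms unfolding adjoint_trace_ring_def by (force simp: image_subset_iff)
qed

section \<open>Fullness peers from a conductor\<close>

text \<open>
  Multiplication by a conductor element \<open>s\<close> carries \<open>B\<close>-ideals into \<open>C\<close>: a nonzero element \<open>a\<close>
  of an ideal of \<open>C\<close> gives the ideal \<open>a * s * B\<close> of \<open>B\<close> inside it, and an ideal \<open>I\<close> of \<open>B\<close>
  contains the ideal \<open>s * I\<close> of \<open>C\<close>.
\<close>

lemma fullness_peers_of_conductor:
  fixes B C :: "'k::field set"
  assumes B: "subring B ring_of_type_algebra" and C: "subring C ring_of_type_algebra"
    and "C \<subseteq> B" and "s \<in> B" and "s \<noteq> 0" and sB: "\<And>r. r \<in> B \<Longrightarrow> s * r \<in> C"
  shows "fullness_peers C B"
  unfolding fullness_peers_def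
proof (intro conjI allI impI)
  fix I assume I: "ideal I (subring_of C) \<and> I \<noteq> {0}"
  then have I': "I \<subseteq> C" "0 \<in> I" "\<And>x r. x \<in> I \<Longrightarrow> r \<in> C \<Longrightarrow> r * x \<in> I"
    by (auto simp: ideal_subring_of_iff[OF C])
  then obtain a where a: "a \<in> I" "a \<noteq> 0" using I by blast
  have "ideal ((*) (a * s) ` B) (subring_of B)"
    unfolding ideal_subring_of_iff[OF B]
  proof (intro conjI ballI)
    show "(*) (a * s) ` B \<subseteq> B"
      using B a I' \<open>C \<subseteq> B\<close> \<open>s \<in> B\<close> by (auto simp: subring_type_iff)
    show "0 \<in> (*) (a * s) ` B" using subring_zero[OF B] by force
  next
    fix x y assume "x \<in> (*) (a * s) ` B" "y \<in> (*) (a * s) ` B"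
    then show "x + y \<in> (*) (a * s) ` B"
      using B by (auto simp: subring_type_iff simp flip: distrib_left)
  next
    fix r x assume "r \<in> B" "x \<in> (*) (a * s) ` B"
    then obtain y where "y \<in> B" "x = (a * s) * y" by blast
    then have "r * x = (a * s) * (r * y)" "r * y \<in> B"
      using B \<open>r \<in> B\<close> by (simp_all add: subring_type_iff)
    then show "r * x \<in> (*) (a * s) ` B" by blast
  qed
  moreover have "(*) (a * s) ` B \<noteq> {0}"
    using B a \<open>s \<noteq> 0\<close> by (auto simp: subring_type_iff dest!: equalityD1)
  moreover have "(*) (a * s) ` B \<subseteq> I"
    using I'(3)[OF a(1) sB] by (auto simp: ac_simps)
  ultimately show "\<exists>J. ideal J (subring_of B) \<and> J \<noteq> {0} \<and> J \<subseteq> I" by blast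
next
  fix I assume I: "ideal I (subring_of B) \<and> I \<noteq> {0}"
  then have I': "I \<subseteq> B" "0 \<in> I" "\<And>x y. x \<in> I \<Longrightarrow> y \<in> I \<Longrightarrow> x + y \<in> I"
      "\<And>x r. x \<in> I \<Longrightarrow> r \<in> B \<Longrightarrow> r * x \<in> I"
    by (auto simp: ideal_subring_of_iff[OF B])
  then obtain a where a: "a \<in> I" "a \<noteq> 0" using I by blast
  have "ideal ((*) s ` I) (subring_of C)"
    unfolding ideal_subring_of_iff[OF C]
  proof (intro conjI ballI)
    show "(*) s ` I \<subseteq> C" using sB I' by auto
    show "0 \<in> (*) s ` I" using I'(2) by force
  next
    fix x y assume "x \<in> (*) s ` I" "y \<in> (*) s ` I"
    then show "x + y \<in> (*) s ` I"
      using I'(3) by (auto simp flip: distrib_left)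
  next
    fix r x assume "r \<in> C" "x \<in> (*) s ` I"
    then obtain y where "y \<in> I" "x = s * y" by blast
    then have "r * x = s * (r * y)" "r * y \<in> I"
      using I'(4) \<open>C \<subseteq> B\<close> \<open>r \<in> C\<close> by auto
    then show "r * x \<in> (*) s ` I" by blast
  qed
  moreover have "(*) s ` I \<noteq> {0}"
    using a \<open>s \<noteq> 0\<close> by (auto dest!: equalityD1)
  moreover have "(*) s ` I \<subseteq> I"
    using I'(4) \<open>s \<in> B\<close> by auto
  ultimately show "\<exists>J. ideal J (subring_of C) \<and> J \<noteq> {0} \<and> J \<subseteq> I" by blast
qed (use B C in auto)

section \<open>Characteristic different from two\<close>

lemma one_eq_zero_of_odd_order:
  assumes "ring R" and odd: "odd (card (carrier R))"
    and two: "\<one>\<^bsub>R\<^esub> \<oplus>\<^bsub>R\<^esub> \<one>\<^bsub>R\<^esub> = \<zero>\<^bsub>R\<^esub>"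
  shows "\<one>\<^bsub>R\<^esub> = \<zero>\<^bsub>R\<^esub>"
proof -
  interpret ring R by fact
  obtain n where n: "card (carrier R) = 2 * n + 1" using odd by (rule oddE)
  have "[card (carrier R)] \<cdot>\<^bsub>R\<^esub> \<one>\<^bsub>R\<^esub> = \<zero>\<^bsub>R\<^esub>"
    using add.pow_order_eq_1[of "\<one>\<^bsub>R\<^esub>"] by (simp add: Coset.order_def)
  moreover have "[(2 * n + 1)] \<cdot>\<^bsub>R\<^esub> \<one>\<^bsub>R\<^esub> = \<one>\<^bsub>R\<^esub>"
  proof (induction n)
    case (Suc n)
    have "[(2 * Suc n + 1)] \<cdot>\<^bsub>R\<^esub> \<one>\<^bsub>R\<^esub> = [(2 * n + 1)] \<cdot>\<^bsub>R\<^esub> \<one>\<^bsub>R\<^esub> \<oplus>\<^bsub>R\<^esub> (\<one>\<^bsub>R\<^esub> \<oplus>\<^bsub>R\<^esub> \<one>\<^bsub>R\<^esub>)"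
      by (simp add: a_assoc)
    then show ?case by (simp only: Suc.IH two r_zero one_closed)
  qed simp
  ultimately show ?thesis by (simp add: n)
qed

text \<open>
  If \<open>2 = 0\<close>, then the order of the unit in the additive group of each factor divides both \<open>2\<close>
  and a power of \<open>p\<close>, so the unit and the zero agree in every factor, hence in the ring.
\<close>

lemma two_neq_zero_of_local_pro_p:
  assumes A: "local_pro_p_ring TYPE('i) p
      TYPE('a::{idom, topological_ab_group_add, topological_semigroup_mult})"
    and "odd p"
  shows "(2 :: 'a) \<noteq> 0"
proof
  assume "(2 :: 'a) = 0"
  then have two: "(1 :: 'a) + 1 = 0" by simp
  from A[unfolded local_pro_p_ring_def, THEN conjunct2, THEN conjunct2]
  obtain I :: "'i set" and lq and R :: "'i \<Rightarrow> nat ring" and f \<phi>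
    where sys: "inverse_system I lq R f"
      and order: "\<forall>i\<in>I. finite (carrier (R i)) \<and> (\<exists>k. card (carrier (R i)) = p ^ k)"
      and \<phi>: "\<phi> \<in> ring_iso (ring_of_type_algebra :: 'a ring) (inverse_limit I lq R f)"
    by (elim exE conjE bexE)
  have hom: "\<phi> \<in> ring_hom (ring_of_type_algebra :: 'a ring) (inverse_limit I lq R f)"
    and inj: "inj \<phi>"
    using \<phi> by (auto simp: ring_iso_def bij_betw_def)
  have add: "\<phi> (x + y) i = \<phi> x i \<oplus>\<^bsub>R i\<^esub> \<phi> y i" if "i \<in> I" for x y i
  proof -
    have "\<phi> (x + y) = \<phi> x \<oplus>\<^bsub>inverse_limit I lq R f\<^esub> \<phi> y"
      using ring_hom_add[OF hom, of x y] by simp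
    then show ?thesis using that by (simp add: inverse_limit_def)
  qed
  have one: "\<phi> 1 = \<one>\<^bsub>inverse_limit I lq R f\<^esub>"
    using ring_hom_one[OF hom] by simp
  have car: "\<phi> x \<in> (\<Pi>\<^sub>E i\<in>I. carrier (R i))" for x
    using ring_hom_closed[OF hom, of x] by (simp add: inverse_limit_def)
  have "\<phi> 1 i = \<phi> 0 i" if i: "i \<in> I" for i
  proof -
    interpret R: ring "R i" using sys i unfolding inverse_system_def by blast
    have "\<phi> 0 i \<oplus>\<^bsub>R i\<^esub> \<phi> 0 i = \<phi> 0 i"
      by (rule add[OF i, of 0 0, unfolded add_0_left, symmetric])
    then have zero: "\<phi> 0 i = \<zero>\<^bsub>R i\<^esub>"
      using R.add.r_cancel_one[OF PiE_mem[OF car i] PiE_mem[OF car i]] by simp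
    have one_i: "\<phi> 1 i = \<one>\<^bsub>R i\<^esub>" using i by (simp add: one inverse_limit_def)
    have "\<phi> 1 i \<oplus>\<^bsub>R i\<^esub> \<phi> 1 i = \<phi> 0 i"
      by (rule add[OF i, of 1 1, unfolded two, symmetric])
    then have "\<one>\<^bsub>R i\<^esub> \<oplus>\<^bsub>R i\<^esub> \<one>\<^bsub>R i\<^esub> = \<zero>\<^bsub>R i\<^esub>"
      unfolding zero one_i .
    moreover obtain k where "card (carrier (R i)) = p ^ k" using order i by blast
    then have "odd (card (carrier (R i)))" using \<open>odd p\<close> by simp
    ultimately show ?thesis
      unfolding zero one_i by (intro one_eq_zero_of_odd_order[OF R.ring_axioms])
  qed
  then have "\<phi> 1 = \<phi> 0" by (rule PiE_ext[OF car car])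
  then show False using inj by (simp add: inj_eq)
qed

section \<open>Traces of congruence subgroups\<close>

unbundle no Formal_Power_Series.fps_syntax

lemma trace_2: "trace (Y :: 'b::comm_semiring_1 ^ 2 ^ 2) = Y $ 1 $ 1 + Y $ 2 $ 2"
  by (simp add: trace_def sum_2)

lemma matrix_inv_right:
  fixes x :: "'b::semiring_1 ^ 'n ^ 'n"
  assumes "invertible x"
  shows "x ** matrix_inv x = mat 1"
  using someI_ex[OF assms[unfolded invertible_def]] by (auto simp: matrix_inv_def)

lemma trace_conjugate:
  fixes x y :: "'b::comm_ring_1 ^ 'n ^ 'n"
  assumes "invertible x"
  shows "trace (matrix_inv x ** y ** x) = trace y"
proof -
  have "trace (matrix_inv x ** y ** x) = trace (x ** (matrix_inv x ** y))"
    by (rule trace_mul_sym)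
  then show ?thesis
    by (simp add: matrix_mul_assoc matrix_inv_right[OF assms])
qed

lemma det_conjugate:
  fixes x y :: "'b::comm_ring_1 ^ 'n ^ 'n"
  assumes "invertible x"
  shows "det (matrix_inv x ** y ** x) = det y"
proof -
  have "det x * det (matrix_inv x) = 1"
    using arg_cong[OF matrix_inv_right[OF assms], of det] by (simp add: det_mul)
  moreover have "det (matrix_inv x ** y ** x) = (det x * det (matrix_inv x)) * det y"
    by (simp add: det_mul ac_simps)
  ultimately show ?thesis by simp
qed

lemma gma_embedding_trace_det:
  assumes "gma_embedding sM sN m \<iota>"
  shows "trace (\<iota> z) = to_fract (gma_trace z)" and "det (\<iota> z) = to_fract (gma_det m z)"
  using assms
  by (auto simp: gma_embedding_def gma_trace_def gma_det_def trace_2 det_2 split: prod.split)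

lemma mem_congruence_subgroup:
  fixes B :: "'k::field set" and Y :: "'k ^ 2 ^ 2"
  assumes B: "subring B ring_of_type_algebra" and \<bb>: "ideal \<bb> (subring_of B)"
    and mem: "\<And>i j. Y $ i $ j \<in> B" and det: "det Y = 1"
    and diff: "\<And>i j. Y $ i $ j - (mat 1 :: 'k ^ 2 ^ 2) $ i $ j \<in> \<bb>"
  shows "Y \<in> congruence_subgroup B \<bb>"
proof -
  interpret \<bb>: ideal \<bb> "subring_of B" by fact
  have "\<bb> +>\<^bsub>subring_of B\<^esub> (Y $ i $ j) = \<bb> +>\<^bsub>subring_of B\<^esub> ((mat 1 :: 'k ^ 2 ^ 2) $ i $ j)" for i j
  proof -
    let ?e = "(mat 1 :: 'k ^ 2 ^ 2) $ i $ j"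
    have "?e \<in> B" using B subring_zero[OF B] by (simp add: mat_def subring_type_iff)
    moreover have "Y $ i $ j \<in> \<bb> +>\<^bsub>subring_of B\<^esub> ?e"
      using diff[of i j] by (auto simp: a_r_coset_def' intro!: bexI[of _ "Y $ i $ j - ?e"])
    ultimately show ?thesis
      using \<bb>.a_repr_independence' by simp
  qed
  then show ?thesis using mem det by (auto simp: congruence_subgroup_def)
qed

text \<open>
  The witness is the product of an upper unipotent matrix with entry \<open>a\<close> and a lower unipotent
  matrix with entry \<open>b\<close>; both factors are congruent to the identity modulo \<open>\<bb>\<close>.
\<close>

lemma congruence_subgroup_has_trace:
  fixes B :: "'k::field set"
  assumes B: "subring B ring_of_type_algebra" and \<bb>: "ideal \<bb> (subring_of B)"
    and ab: "a \<in> \<bb>" "b \<in> \<bb>"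
  shows "\<exists>Y \<in> congruence_subgroup B \<bb>. trace Y = 2 + a * b"
proof
  let ?Y = "vector [vector [1 + a * b, a], vector [b, 1]] :: 'k ^ 2 ^ 2"
  have I: "\<bb> \<subseteq> B" "0 \<in> \<bb>" "a * b \<in> \<bb>"
    using \<bb> ab by (auto simp: ideal_subring_of_iff[OF B])
  have "?Y $ i $ j \<in> B" for i j
    using exhaust_2[of i] exhaust_2[of j] I ab B by (auto simp: subring_type_iff)
  moreover have "?Y $ i $ j - (mat 1 :: 'k ^ 2 ^ 2) $ i $ j \<in> \<bb>" for i j
    using exhaust_2[of i] exhaust_2[of j] I ab by (auto simp: mat_def)
  ultimately show "?Y \<in> congruence_subgroup B \<bb>"
    by (intro mem_congruence_subgroup[OF B \<bb>]) (auto simp: det_2)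
  show "trace ?Y = 2 + a * b" by (simp add: trace_2)
qed

lemma full_imp_trace_square:
  fixes t d :: "'g \<Rightarrow> 'a::{idom, topological_space}" and x Y :: "'a fract ^ 2 ^ 2"
  assumes rep: "td_representation G t d sM sN m \<rho>" and emb: "gma_embedding sM sN m \<iota>"
    and inv: "invertible x"
    and Y: "Y \<in> (\<lambda>g. matrix_inv x ** \<iota> (\<rho> g) ** x) ` carrier G" and det: "det Y = 1"
  shows "(trace Y)\<^sup>2 \<in> to_fract ` adjoint_trace_ring G t d"
proof -
  obtain g where g: "g \<in> carrier G" and Y_eq: "Y = matrix_inv x ** \<iota> (\<rho> g) ** x"
    using Y by blast
  have "trace Y = to_fract (t g)" "det Y = to_fract (d g)"
    using rep g
    by (simp_all add: Y_eq trace_conjugate[OF inv] det_conjugate[OF inv]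
        gma_embedding_trace_det[OF emb] td_representation_def)
  moreover from this have "d g = 1" using det by (metis to_fract_1 to_fract_eq_iff)
  ultimately show ?thesis
    using trace_square_in_adjoint_trace_ring[OF g, of d t]
    by (auto simp: power2_eq_square simp flip: to_fract_mult)
qed

text \<open>
  The witness is \<open>2 * s\<^sup>4\<close> for a nonzero \<open>s \<in> \<bb>\<close>.  A subring that contains
  \<open>4 * z + z\<^sup>2 = (2 + z)\<^sup>2 - 4\<close> for all \<open>z\<close> in the additive group \<open>s\<^sup>2 B\<close> also contains
  \<open>2 * z * w\<close> for all \<open>z\<close> and \<open>w\<close> in it, by polarization.
\<close>

lemma full_imp_multiple_subset_adjoint_trace_ring:
  fixes t d :: "'g \<Rightarrow> 'a::{idom, topological_space}"
  assumes two: "(2 :: 'a) \<noteq> 0" and B: "subring B ring_of_type_algebra"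
    and full: "full TYPE('m::ab_group_add) TYPE('n::ab_group_add) G t d B"
  shows "\<exists>c\<in>B. c \<noteq> 0 \<and> (\<forall>r\<in>B. c * r \<in> to_fract ` adjoint_trace_ring G t d)"
proof -
  let ?A0 = "to_fract ` adjoint_trace_ring G t d"
  obtain sM :: "'a \<Rightarrow> 'm \<Rightarrow> 'm" and sN :: "'a \<Rightarrow> 'n \<Rightarrow> 'n" and m \<rho> \<iota> \<bb> x
    where rep: "td_representation G t d sM sN m \<rho>" and emb: "gma_embedding sM sN m \<iota>"
      and \<bb>: "ideal \<bb> (subring_of B)" "\<bb> \<noteq> {0}" and inv: "invertible x"
      and sub: "congruence_subgroup B \<bb> \<subseteq> (\<lambda>g. matrix_inv x ** \<iota> (\<rho> g) ** x) ` carrier G"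
    using full unfolding full_def by blast
  have I: "\<bb> \<subseteq> B" "0 \<in> \<bb>" "\<And>r y. r \<in> B \<Longrightarrow> y \<in> \<bb> \<Longrightarrow> r * y \<in> \<bb>"
    using \<bb> by (auto simp: ideal_subring_of_iff[OF B])
  then obtain s where s: "s \<in> \<bb>" "s \<noteq> 0" using \<bb>(2) by blast
  have A0: "subring ?A0 ring_of_type_algebra"
    by (rule subring_to_fract_image[OF subring_adjoint_trace_ring])
  have A0_diff: "y - z \<in> ?A0" if "y \<in> ?A0" "z \<in> ?A0" for y z
    using A0 that unfolding subring_type_iff diff_conv_add_uminus[of y z] by blast
  have four: "4 \<in> ?A0"
  proof -
    have "(1 + 1) + (1 + 1) \<in> ?A0" using A0 unfolding subring_type_iff by blast
    then show ?thesis by simp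
  qed
  have quad: "(2 + s\<^sup>2 * r)\<^sup>2 - 4 \<in> ?A0" if r: "r \<in> B" for r
  proof -
    obtain Y where Y: "Y \<in> congruence_subgroup B \<bb>" "trace Y = 2 + (r * s) * s"
      using congruence_subgroup_has_trace[OF B \<bb>(1) I(3)[OF r s(1)] s(1)] by blast
    then have "(trace Y)\<^sup>2 \<in> ?A0"
      using sub by (intro full_imp_trace_square[OF rep emb inv]) (auto simp: congruence_subgroup_def)
    then show ?thesis
      using A0_diff[OF _ four] Y(2) by (simp add: power2_eq_square ac_simps)
  qed
  have B1: "1 \<in> B" and B_add: "\<And>y z. y \<in> B \<Longrightarrow> z \<in> B \<Longrightarrow> y + z \<in> B"
    and B_mult: "\<And>y z. y \<in> B \<Longrightarrow> z \<in> B \<Longrightarrow> y * z \<in> B"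
    using B by (auto simp: subring_type_iff)
  have "2 * s ^ 4 * r \<in> ?A0" if r: "r \<in> B" for r
  proof -
    \<comment> \<open>polarization at the elements \<open>s\<^sup>2\<close> and \<open>s\<^sup>2 * r\<close> of \<open>s\<^sup>2 B\<close>\<close>
    have "((2 + s\<^sup>2 * (1 + r))\<^sup>2 - 4) - ((2 + s\<^sup>2 * 1)\<^sup>2 - 4) - ((2 + s\<^sup>2 * r)\<^sup>2 - 4) \<in> ?A0"
      by (intro A0_diff quad B_add B1 r)
    also have "((2 + s\<^sup>2 * (1 + r))\<^sup>2 - 4) - ((2 + s\<^sup>2 * 1)\<^sup>2 - 4) - ((2 + s\<^sup>2 * r)\<^sup>2 - 4)
        = 2 * s ^ 4 * r"
      by (simp add: power2_eq_square power4_eq_xxxx algebra_simps)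
    finally show ?thesis .
  qed
  moreover have "2 * s ^ 4 \<in> B"
  proof -
    have "s \<in> B" using s I by blast
    then have "(1 + 1) * (s * s * s * s) \<in> B" by (intro B_mult B_add B1)
    then show ?thesis by (simp add: power4_eq_xxxx)
  qed
  moreover have "(2 :: 'a fract) \<noteq> 0"
  proof -
    have "to_fract (2 :: 'a) = 2" by (metis one_add_one to_fract_1 to_fract_add)
    then show ?thesis using two by (metis to_fract_eq_0_iff)
  qed
  ultimately show ?thesis using s by (intro bexI[of _ "2 * s ^ 4"]) auto
qed

theorem theorem5p3:
  fixes p :: nat
    and G :: "('g, 'x) monoid_scheme"
    and T :: "'g topology"
    and t d :: "'g \<Rightarrow> 'a::{idom, topological_ab_group_add, topological_semigroup_mult}"
    and B :: "'a fract set"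
  assumes "Factorial_Ring.prime p" and "odd p"
    and "profinite_group G T" and "p_finite p G T"
    and "local_pro_p_ring TYPE('i) p TYPE('a)"
    and "noetherian_ring (ring_of_type_algebra :: 'a ring)"
    and "continuous_pseudorepresentation G T t d"
    and "subring B (ring_of_type_algebra :: 'a fract ring)"
    and "full TYPE('m::ab_group_add) TYPE('n::ab_group_add) G t d B"
  shows "fullness_peers (B \<inter> to_fract ` adjoint_trace_ring G t d) B \<and>
         B \<inter> to_fract ` adjoint_trace_ring G t d \<subseteq> to_fract ` adjoint_trace_ring G t d"
proof -
  let ?A0 = "to_fract ` adjoint_trace_ring G t d"
  have B: "subring B (ring_of_type_algebra :: 'a fract ring)" by fact
  obtain c where c: "c \<in> B" "c \<noteq> 0" and cB: "\<And>r. r \<in> B \<Longrightarrow> c * r \<in> ?A0"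
    using full_imp_multiple_subset_adjoint_trace_ring[OF
        two_neq_zero_of_local_pro_p[OF assms(5) \<open>odd p\<close>] B assms(9)] by blast
  have "subring (B \<inter> ?A0) ring_of_type_algebra"
    by (intro ring.subring_inter[OF ring_from_type_algebra] B
        subring_to_fract_image subring_adjoint_trace_ring)
  moreover have "c * r \<in> B \<inter> ?A0" if "r \<in> B" for r
    using B c cB that by (auto simp: subring_type_iff)
  ultimately have "fullness_peers (B \<inter> ?A0) B"
    using B c by (intro fullness_peers_of_conductor[where s = c]) auto
  then show ?thesis by blast
qed

end
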